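(* Let $X$ be a nonzero finite-dimensional Banach space over $\mathbb{R}$ or $\mathbb{C}$, let $1\leq p<\infty$ and $k\in\mathbb{N}$. Then for every $\mathcal{T}=(T_1,\ldots,T_k)\in L(X)^k$, \[w_p(\mathcal{T})=\max\Big\{\Big(\sum_{i=1}^k |x^*(T_ix)|^p\Big)^{1/p}:(x,x^* )\in G_X\Big\},\] where $G_X=\{(x,x^* )\in \Pi_X:x\in E_X,\ x^*\in E_{X^*}\}$ (in particular the maximum is attained).
   Context: $L(X)$ is the space of bounded linear operators on $X$. $S_X$ and $B_X$ denote the unit sphere and closed unit ball of $X$, $X^*$ the dual space, $E_X$ the set of extreme points of $B_X$ (and $E_{X^*}$ the set of extreme points of $B_{X^*}$), and $\Pi_X=\{(x,x^* )\in S_X\times S_{X^*}: x^*(x)=1\}$. For $\mathcal{T}=(T_1,\ldots,T_k)\in L(X)^k$, the $p$-th joint numerical radius is $w_p(\mathcal{T})=\sup\{(\sum_{i=1}^k|x^*(T_ix)|^p)^{1/p}:(x,x^* )\in\Pi_X\}$. *)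

theory Defs
  imports "HOL-Analysis.Analysis"
begin

text \<open>
  Normed spaces over a scalar field \<open>'k\<close> (used for \<open>'k = real\<close> and \<open>'k = complex\<close>).
  The library has no class of complex normed spaces. A complex normed space is therefore a
  real normed space together with a compatible multiplication by scalars from \<open>'k\<close>; for
  \<open>'k = real\<close> the only such multiplication is \<open>scaleR\<close>.
\<close>

locale normed_space_over = vector_space sc
  for sc :: "'k::real_normed_field \<Rightarrow> 'a::real_normed_vector \<Rightarrow> 'a" +
  assumes sc_of_real: "sc (of_real r) x = r *\<^sub>R x"
    and norm_sc: "norm (sc c x) = norm c * norm x"

lemma normed_space_over_scaleR:
  "normed_space_over (scaleR :: real \<Rightarrow> 'a::real_normed_vector \<Rightarrow> 'a)"
  by unfold_locales (auto simp: algebra_simps)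

lemma normed_space_over_mult:
  "normed_space_over ((*) :: 'k::real_normed_field \<Rightarrow> 'k \<Rightarrow> 'k)"
  by unfold_locales (auto simp: algebra_simps norm_mult scaleR_conv_of_real)

definition finite_dim :: "('k::field \<Rightarrow> 'a::ab_group_add \<Rightarrow> 'a) \<Rightarrow> bool" where
  "finite_dim sc \<longleftrightarrow> (\<exists>B. finite_dimensional_vector_space sc B)"

text \<open>
  The type of bounded real-linear maps carries the operator norm; \<open>L(X)\<close> and \<open>X\<^sup>*\<close> are
  the subspaces of those maps that are linear over the scalar field \<open>'k\<close>.
\<close>

definition operators ::
    "('k::real_normed_field \<Rightarrow> 'a::real_normed_vector \<Rightarrow> 'a) \<Rightarrow> ('a \<Rightarrow>\<^sub>L 'a) set" where
  "operators sc = {T. \<forall>c x. blinfun_apply T (sc c x) = sc c (blinfun_apply T x)}"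

definition dual ::
    "('k::real_normed_field \<Rightarrow> 'a::real_normed_vector \<Rightarrow> 'a) \<Rightarrow> ('a \<Rightarrow>\<^sub>L 'k) set" where
  "dual sc = {f. \<forall>c x. blinfun_apply f (sc c x) = c * blinfun_apply f x}"

definition Pi_pairs ::
    "('k::real_normed_field \<Rightarrow> 'a::real_normed_vector \<Rightarrow> 'a) \<Rightarrow> ('a \<times> ('a \<Rightarrow>\<^sub>L 'k)) set" where
  "Pi_pairs sc =
     {(x, f). norm x = 1 \<and> f \<in> dual sc \<and> norm f = 1 \<and> blinfun_apply f x = 1}"

definition G_pairs ::
    "('k::real_normed_field \<Rightarrow> 'a::real_normed_vector \<Rightarrow> 'a) \<Rightarrow> ('a \<times> ('a \<Rightarrow>\<^sub>L 'k)) set" where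
  "G_pairs sc =
     {(x, f) \<in> Pi_pairs sc. x extreme_point_of cball 0 1 \<and>
        f extreme_point_of (dual sc \<inter> cball 0 1)}"

definition joint_value ::
    "real \<Rightarrow> nat \<Rightarrow> (nat \<Rightarrow> 'a \<Rightarrow>\<^sub>L 'a) \<Rightarrow> 'a::real_normed_vector \<times> ('a \<Rightarrow>\<^sub>L 'k::real_normed_field) \<Rightarrow> real" where
  "joint_value p k T = (\<lambda>(x, f).
     (\<Sum>i=1..k. norm (blinfun_apply f (blinfun_apply (T i) x)) powr p) powr (1 / p))"

definition joint_numerical_radius ::
    "('k::real_normed_field \<Rightarrow> 'a::real_normed_vector \<Rightarrow> 'a) \<Rightarrow> real \<Rightarrow> nat \<Rightarrow> (nat \<Rightarrow> 'a \<Rightarrow>\<^sub>L 'a) \<Rightarrow> real" where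
  "joint_numerical_radius sc p k T = (SUP z \<in> Pi_pairs sc. joint_value p k T z)"

definition is_maximum :: "real \<Rightarrow> real set \<Rightarrow> bool" where
  "is_maximum m S \<longleftrightarrow> m \<in> S \<and> (\<forall>s\<in>S. s \<le> m)"

end

theory Submission imports Defs begin

text \<open>
  By compactness \<open>\<Sum>i. |f (T i x)| powr p\<close> attains its maximum over all admissible pairs at some
  \<open>(x\<^sub>0, f\<^sub>0)\<close>. For fixed \<open>f\<^sub>0\<close> the points \<open>x\<close> of the unit ball with \<open>f\<^sub>0 x = 1\<close> form a compact face,
  and the sum is convex in \<open>x\<close>, so \<open>x\<^sub>0\<close> can be replaced by an extreme point \<open>x\<^sub>1\<close> of the face, which is
  an extreme point of the ball. For fixed \<open>x\<^sub>1\<close> the same argument in the dual ball replaces \<open>f\<^sub>0\<close>.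
  Instead of the Krein-Milman theorem: among the maximizers of a convex function, a maximizer
  of a strictly convex continuous function is an extreme point, and in finite dimension the sum
  of the squared coordinates is such a function.
\<close>

section \<open>Coordinates and compactness in finite-dimensional real normed spaces\<close>

text \<open>Tychonoff: a product of compact intervals is compact in the pointwise topology.
  Coefficients are total functions, so those outside \<open>B\<close> are pinned to 0 by degenerate
  intervals.\<close>

lemma compact_bounded_coefficients:
  fixes r :: real
  shows "compact {c::'a \<Rightarrow> real. \<forall>b. \<bar>c b\<bar> \<le> (if b \<in> B then r else 0)}"
proof -
  have "compactin (product_topology (\<lambda>_::'a. euclidean :: real topology) UNIV)
          (PiE UNIV (\<lambda>b. {- (if b \<in> B then r else 0) .. (if b \<in> B then r else 0)}))"
    unfolding compactin_PiE by (auto simp del: atLeastAtMost_iff)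
  moreover have "PiE UNIV (\<lambda>b. {- (if b \<in> B then r else 0) .. (if b \<in> B then r else 0)})
      = {c::'a \<Rightarrow> real. \<forall>b. \<bar>c b\<bar> \<le> (if b \<in> B then r else 0)}"
    by (auto simp only: PiE_UNIV_domain Pi_iff abs_le_iff atLeastAtMost_iff mem_Collect_eq
        minus_le_iff)
  ultimately show ?thesis
    by (simp add: euclidean_product_topology)
qed

lemma continuous_on_combination:
  fixes B :: "'a::real_normed_vector set"
  shows "continuous_on S (\<lambda>c. \<Sum>b\<in>B. c b *\<^sub>R b)"
  by (intro continuous_intros continuous_on_subset[OF continuous_on_product_coordinates]) auto

text \<open>\<open>C\<close> is the minimum of the norm of the combination over coefficient vectors
  of absolute sum 1; it exists by compactness and is positive by independence. Homogeneity extends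
  the bound to all \<open>c\<close>.\<close>

lemma independent_norm_lower_bound:
  fixes B :: "'a::real_normed_vector set"
  assumes "finite B" "independent B"
  obtains C where "C > 0" "\<And>c. C * (\<Sum>b\<in>B. \<bar>c b\<bar>) \<le> norm (\<Sum>b\<in>B. c b *\<^sub>R b)"
proof (cases "B = {}")
  case True
  then show ?thesis by (intro that[of 1]) auto
next
  case False
  \<comment> \<open>The unit sphere of the absolute-sum norm on coefficients supported in
    \<open>B\<close>. It would be empty for \<open>B = {}\<close>, hence the case
    distinction.\<close>
  define S where "S = {c::'a \<Rightarrow> real. \<forall>b. \<bar>c b\<bar> \<le> (if b \<in> B then 1 else 0)}
    \<inter> (\<lambda>c. \<Sum>b\<in>B. \<bar>c b\<bar>) -` {1}"
  have "compact S"
    unfolding S_def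
    by (intro compact_Int_closed compact_bounded_coefficients closed_vimage continuous_intros
        continuous_on_product_coordinates)
  have normalized: "(\<lambda>b. if b \<in> B then c b / (\<Sum>b\<in>B. \<bar>c b\<bar>) else 0) \<in> S"
    if "(\<Sum>b\<in>B. \<bar>c b\<bar>) \<noteq> 0" for c
  proof -
    have "(\<Sum>b\<in>B. \<bar>c b\<bar>) > 0" using that by (simp add: order.not_eq_order_implies_strict sum_nonneg)
    moreover have "\<bar>c b\<bar> \<le> (\<Sum>b\<in>B. \<bar>c b\<bar>)" if "b \<in> B" for b
      using that assms(1) by (intro member_le_sum) auto
    ultimately show ?thesis
      unfolding S_def by (auto simp: abs_divide simp flip: sum_divide_distrib)
  qed
  from False assms(1) have "(\<Sum>b\<in>B. \<bar>1::real\<bar>) \<noteq> 0" by simp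
  from normalized[OF this] have "S \<noteq> {}" by blast
  have "continuous_on S (\<lambda>c. norm (\<Sum>b\<in>B. c b *\<^sub>R b))"
    by (intro continuous_on_norm continuous_on_combination)
  from continuous_attains_inf[OF \<open>compact S\<close> \<open>S \<noteq> {}\<close> this] obtain c0 where c0: "c0 \<in> S"
    and min: "\<And>c. c \<in> S \<Longrightarrow> norm (\<Sum>b\<in>B. c0 b *\<^sub>R b) \<le> norm (\<Sum>b\<in>B. c b *\<^sub>R b)"
    by blast
  \<comment> \<open>If the minimum were 0, independence would make all \<open>c0 b\<close> vanish,
    against their absolute sum being 1.\<close>
  have "(\<Sum>b\<in>B. c0 b *\<^sub>R b) \<noteq> 0"
  proof
    assume "(\<Sum>b\<in>B. c0 b *\<^sub>R b) = 0"
    then have "\<forall>b\<in>B. c0 b = 0"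
      using independentD[OF assms(2,1) order_refl] by blast
    then show False using c0 by (simp add: S_def)
  qed
  moreover have "norm (\<Sum>b\<in>B. c0 b *\<^sub>R b) * (\<Sum>b\<in>B. \<bar>c b\<bar>) \<le> norm (\<Sum>b\<in>B. c b *\<^sub>R b)" for c
  proof (cases "(\<Sum>b\<in>B. \<bar>c b\<bar>) = 0")
    case False
    define s where "s = (\<Sum>b\<in>B. \<bar>c b\<bar>)"
    have s: "s > 0"
      using False unfolding s_def by (simp add: order.not_eq_order_implies_strict sum_nonneg)
    have "norm (\<Sum>b\<in>B. c0 b *\<^sub>R b) \<le> norm (\<Sum>b\<in>B. (c b / s) *\<^sub>R b)"
      using min[OF normalized[OF False]] unfolding s_def by simp
    also have "(\<Sum>b\<in>B. (c b / s) *\<^sub>R b) = (1 / s) *\<^sub>R (\<Sum>b\<in>B. c b *\<^sub>R b)"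
      by (simp add: scaleR_sum_right)
    finally show ?thesis using s by (simp add: field_simps flip: s_def)
  qed simp
  ultimately show ?thesis by (intro that) auto
qed

lemma finite_span_obtain_basis:
  fixes S :: "'a::real_vector set"
  assumes "finite S" "span S = UNIV"
  obtains B where "finite B" "independent B" "span B = (UNIV :: 'a set)"
proof -
  obtain B where "B \<subseteq> S" "independent B" "S \<subseteq> span B"
    using maximal_independent_subset by blast
  moreover from this have "span B = UNIV"
    using span_minimal[of S "span B"] assms(2) by auto
  ultimately show ?thesis
    using that finite_subset assms(1) by blast
qed

lemma span_UNIV_combination:
  fixes B :: "'a::real_vector set"
  assumes "finite B" "independent B" "span B = UNIV"
  shows "(\<Sum>b\<in>B. representation B x b *\<^sub>R b) = x"
  using assms by (intro sum_representation_eq) auto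

text \<open>Each coordinate of \<open>x\<close> is at most \<open>norm x / C\<close> by the lower
  bound, and \<open>f x\<close> is the combination of the finitely many \<open>f b\<close> with
  these coordinates.\<close>

lemma linear_bounded_finite_span:
  fixes f :: "'a::real_normed_vector \<Rightarrow> 'b::real_normed_vector"
  assumes S: "finite S" "span S = (UNIV :: 'a set)" and f: "linear f"
  shows "bounded_linear f"
proof -
  obtain B where B: "finite B" "independent B" "span B = (UNIV :: 'a set)"
    using S by (rule finite_span_obtain_basis)
  obtain C where C: "C > 0" "\<And>c. C * (\<Sum>b\<in>B. \<bar>c b\<bar>) \<le> norm (\<Sum>b\<in>B. c b *\<^sub>R b)"
    using B independent_norm_lower_bound by metis
  have "norm (f x) \<le> norm x * ((\<Sum>b\<in>B. norm (f b)) / C)" for x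
  proof -
    let ?c = "representation B x"
    have "\<bar>?c b\<bar> \<le> norm x / C" if "b \<in> B" for b
    proof -
      have "\<bar>?c b\<bar> \<le> (\<Sum>b\<in>B. \<bar>?c b\<bar>)"
        using that B by (intro member_le_sum) auto
      also have "\<dots> \<le> norm x / C"
        using C(2)[of ?c] C(1) by (simp add: span_UNIV_combination[OF B] field_simps)
      finally show ?thesis .
    qed
    then have "(\<Sum>b\<in>B. norm (?c b *\<^sub>R f b)) \<le> (\<Sum>b\<in>B. norm x / C * norm (f b))"
      unfolding norm_scaleR by (intro sum_mono mult_right_mono) auto
    moreover have "f x = (\<Sum>b\<in>B. ?c b *\<^sub>R f b)"
      using f span_UNIV_combination[OF B, of x] by (metis (no_types, lifting) linear_sum linear_scale sum.cong)
    moreover have "(\<Sum>b\<in>B. norm x / C * norm (f b)) = norm x * ((\<Sum>b\<in>B. norm (f b)) / C)"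
      by (simp add: sum_distrib_left sum_divide_distrib)
    ultimately show ?thesis
      using norm_sum[of "\<lambda>b. ?c b *\<^sub>R f b" B] by simp
  qed
  then show ?thesis
    using linear_add[OF f] linear_scale[OF f] by (rule bounded_linear_intro[rotated 2])
qed

text \<open>The lower bound confines the coordinates of points of the ball to a compact box, so the
  ball is a closed subset of a continuous image of that box.\<close>

lemma compact_cball_finite_span:
  assumes S: "finite S" "span S = (UNIV :: 'a::real_normed_vector set)"
  shows "compact (cball (0::'a) r)"
proof -
  obtain B where B: "finite B" "independent B" "span B = (UNIV :: 'a set)"
    using S by (rule finite_span_obtain_basis)
  obtain C where C: "C > 0" "\<And>c. C * (\<Sum>b\<in>B. \<bar>c b\<bar>) \<le> norm (\<Sum>b\<in>B. c b *\<^sub>R b)"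
    using B independent_norm_lower_bound by metis
  let ?K = "{c::'a \<Rightarrow> real. \<forall>b. \<bar>c b\<bar> \<le> (if b \<in> B then r / C else 0)}"
  have K: "compact ((\<lambda>c. \<Sum>b\<in>B. c b *\<^sub>R b) ` ?K)"
    by (intro compact_continuous_image continuous_on_combination compact_bounded_coefficients)
  have "cball 0 r \<subseteq> (\<lambda>c. \<Sum>b\<in>B. c b *\<^sub>R b) ` ?K"
  proof
    fix x :: 'a assume x: "x \<in> cball 0 r"
    let ?c = "representation B x"
    have "\<bar>?c b\<bar> \<le> (if b \<in> B then r / C else 0)" for b
    proof (cases "b \<in> B")
      case True
      then have "\<bar>?c b\<bar> \<le> (\<Sum>b\<in>B. \<bar>?c b\<bar>)"
        using B by (intro member_le_sum) auto
      also have "\<dots> \<le> norm x / C"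
        using C(2)[of ?c] C(1) by (simp add: span_UNIV_combination[OF B] field_simps)
      also have "\<dots> \<le> r / C"
        using x C(1) by (simp add: divide_right_mono)
      finally show ?thesis using True by simp
    next
      case False
      then show ?thesis using representation_ne_zero by fastforce
    qed
    then show "x \<in> (\<lambda>c. \<Sum>b\<in>B. c b *\<^sub>R b) ` ?K"
      by (intro image_eqI[of _ _ ?c]) (simp_all add: span_UNIV_combination[OF B])
  qed
  then have "(\<lambda>c. \<Sum>b\<in>B. c b *\<^sub>R b) ` ?K \<inter> cball 0 r = cball 0 r"
    by (rule Int_absorb1)
  with compact_Int_closed[OF K closed_cball, of 0 r] show ?thesis
    by (simp only:)
qed

text \<open>The rank-one maps sending \<open>x\<close> to a coordinate of \<open>x\<close> times a
  basis vector of the target form a finite spanning set. Compactness of balls and the maximum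
  principle thereby apply to functionals as well.\<close>

lemma finite_span_blinfun:
  fixes S :: "'a::real_normed_vector set"
  assumes S: "finite S" "span S = UNIV"
  obtains E where "finite E" "span E = (UNIV :: ('a \<Rightarrow>\<^sub>L 'b::euclidean_space) set)"
proof -
  obtain B where B: "finite B" "independent B" "span B = (UNIV :: 'a set)"
    using S by (rule finite_span_obtain_basis)
  define e where "e = (\<lambda>(b, i::'b). Blinfun (\<lambda>x. representation B x b *\<^sub>R i))"
  have e: "blinfun_apply (e (b, i)) x = representation B x b *\<^sub>R i" for b i x
  proof -
    have "linear (\<lambda>x. representation B x b *\<^sub>R i)"
      using B by (intro linearI) (auto simp: representation_add representation_scale algebra_simps)
    then show ?thesis
      unfolding e_def by (simp add: bounded_linear_Blinfun_apply linear_bounded_finite_span[OF S])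
  qed
  have "g \<in> span (e ` (B \<times> Basis))" for g :: "'a \<Rightarrow>\<^sub>L 'b"
  proof -
    have "g = (\<Sum>b\<in>B. \<Sum>i\<in>Basis. (g b \<bullet> i) *\<^sub>R e (b, i))"
    proof (rule blinfun_eqI)
      fix x
      have "g x = g (\<Sum>b\<in>B. representation B x b *\<^sub>R b)"
        by (simp add: span_UNIV_combination[OF B])
      also have "\<dots> = (\<Sum>b\<in>B. representation B x b *\<^sub>R g b)"
        by (simp add: blinfun.sum_right blinfun.scaleR_right)
      also have "\<dots> = (\<Sum>b\<in>B. representation B x b *\<^sub>R (\<Sum>i\<in>Basis. (g b \<bullet> i) *\<^sub>R i))"
        by (simp add: euclidean_representation)
      finally show "g x = (\<Sum>b\<in>B. \<Sum>i\<in>Basis. (g b \<bullet> i) *\<^sub>R e (b, i)) x"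
        by (simp add: blinfun.sum_left blinfun.scaleR_left e scaleR_sum_right mult.commute)
    qed
    moreover have "(\<Sum>b\<in>B. \<Sum>i\<in>Basis. (g b \<bullet> i) *\<^sub>R e (b, i)) \<in> span (e ` (B \<times> Basis))"
      by (intro span_sum span_scale span_base) auto
    ultimately show ?thesis by simp
  qed
  then show ?thesis
    using B by (intro that[of "e ` (B \<times> Basis)"]) auto
qed

section \<open>Convex functions, extreme points and faces\<close>

lemma finite_span_strictly_convex:
  fixes S :: "'a::real_normed_vector set"
  assumes S: "finite S" "span S = UNIV"
  obtains q :: "'a \<Rightarrow> real" where "continuous_on UNIV q"
    "\<And>a b u. a \<noteq> b \<Longrightarrow> 0 < u \<Longrightarrow> u < 1 \<Longrightarrow>
       q ((1 - u) *\<^sub>R a + u *\<^sub>R b) < (1 - u) * q a + u * q b"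
proof -
  obtain B where B: "finite B" "independent B" "span B = (UNIV :: 'a set)"
    using S by (rule finite_span_obtain_basis)
  define l where "l = (\<lambda>b x. representation B x b)"
  have l: "bounded_linear (l b)" for b
    using B unfolding l_def
    by (intro linear_bounded_finite_span[OF S] linearI)
      (auto simp: representation_add representation_scale)
  \<comment> \<open>The exact convexity defect of the square function, later summed over the
    coordinates.\<close>
  have gap: "(1 - u) * s\<^sup>2 + u * t\<^sup>2 - ((1 - u) * s + u * t)\<^sup>2 = u * (1 - u) * (s - t)\<^sup>2"
    for s t u :: real by (simp add: power2_eq_square algebra_simps)
  show ?thesis
  proof (rule that[of "\<lambda>x. \<Sum>b\<in>B. (l b x)\<^sup>2"])
    show "continuous_on UNIV (\<lambda>x. \<Sum>b\<in>B. (l b x)\<^sup>2)"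
      by (intro continuous_intros linear_continuous_on l)
  next
    fix x y :: 'a and u :: real assume xy: "x \<noteq> y" and u: "0 < u" "u < 1"
    \<comment> \<open>Distinct points differ in some coordinate, which makes at least one defect
      strictly positive.\<close>
    obtain b0 where b0: "b0 \<in> B" "l b0 x \<noteq> l b0 y"
    proof (rule ccontr, goal_cases)
      case 1
      then have "(\<Sum>b\<in>B. l b x *\<^sub>R b) = (\<Sum>b\<in>B. l b y *\<^sub>R b)"
        by (intro sum.cong) auto
      then show False using xy by (simp add: l_def span_UNIV_combination[OF B])
    qed
    have "0 < (\<Sum>b\<in>B. u * (1 - u) * (l b x - l b y)\<^sup>2)"
      using B(1) b0 u by (intro sum_pos2[of _ b0]) auto
    also have "\<dots> = (\<Sum>b\<in>B. (1 - u) * (l b x)\<^sup>2 + u * (l b y)\<^sup>2 - (l b ((1 - u) *\<^sub>R x + u *\<^sub>R y))\<^sup>2)"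
      using l by (simp add: bounded_linear.linear linear_add linear_scale gap)
    finally show "(\<Sum>b\<in>B. (l b ((1 - u) *\<^sub>R x + u *\<^sub>R y))\<^sup>2)
        < (1 - u) * (\<Sum>b\<in>B. (l b x)\<^sup>2) + u * (\<Sum>b\<in>B. (l b y)\<^sup>2)"
      by (simp add: sum_subtractf sum.distrib sum_distrib_left)
  qed
qed

text \<open>The strictly convex \<open>q\<close> breaks ties among the maximizers of
  \<open>\<phi>\<close>: the chosen maximizer cannot lie strictly between two points of
  \<open>K\<close>.\<close>

lemma convex_maximum_at_extreme_point:
  fixes \<phi> :: "'a::real_normed_vector \<Rightarrow> real"
  assumes S: "finite S" "span S = (UNIV :: 'a set)"
    and K: "compact K" "K \<noteq> {}" and cont: "continuous_on K \<phi>" and conv: "convex_on K \<phi>"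
  obtains x where "x extreme_point_of K" "\<And>y. y \<in> K \<Longrightarrow> \<phi> y \<le> \<phi> x"
proof -
  obtain q :: "'a \<Rightarrow> real" where q: "continuous_on UNIV q"
    and strict: "\<And>a b u. a \<noteq> b \<Longrightarrow> 0 < u \<Longrightarrow> u < 1 \<Longrightarrow>
       q ((1 - u) *\<^sub>R a + u *\<^sub>R b) < (1 - u) * q a + u * q b"
    using S by (rule finite_span_strictly_convex) blast
  obtain m where m: "m \<in> K" "\<And>y. y \<in> K \<Longrightarrow> \<phi> y \<le> \<phi> m"
    using continuous_attains_sup[OF K cont] by blast
  define M where "M = K \<inter> \<phi> -` {\<phi> m}"
  have "compact M"
    unfolding M_def using K(1) cont
    by (metis closed_singleton compact_Int_closed compact_imp_closed continuous_closed_preimage inf.left_idem)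
  moreover have "M \<noteq> {}" using m by (auto simp: M_def)
  ultimately obtain x where x: "x \<in> M" "\<And>y. y \<in> M \<Longrightarrow> q y \<le> q x"
    using continuous_attains_sup[of M q] q continuous_on_subset by blast
  have "x \<notin> open_segment a b" if a: "a \<in> K" and b: "b \<in> K" for a b
  proof
    assume "x \<in> open_segment a b"
    then obtain u where u: "0 < u" "u < 1" and ab: "a \<noteq> b" and xu: "x = (1 - u) *\<^sub>R a + u *\<^sub>R b"
      by (auto simp: in_segment)
    \<comment> \<open>The maximum value is a weighted mean, with positive weights, of values that do
      not exceed it, so both endpoints are maximizers of \<open>\<phi>\<close> and compete in the
      choice of \<open>x\<close>.\<close>
    have "\<phi> m \<le> (1 - u) * \<phi> a + u * \<phi> b"
      using convex_onD[OF conv, of u a b] u a b x(1) by (simp add: xu M_def)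
    moreover have "(1 - u) * \<phi> a \<le> (1 - u) * \<phi> m" "u * \<phi> b \<le> u * \<phi> m"
      using u m(2)[OF a] m(2)[OF b] by auto
    moreover have "\<phi> m = (1 - u) * \<phi> m + u * \<phi> m"
      by (simp add: algebra_simps)
    ultimately have "(1 - u) * \<phi> a = (1 - u) * \<phi> m" "u * \<phi> b = u * \<phi> m"
      by linarith+
    then have "a \<in> M" "b \<in> M" using u a b by (auto simp: M_def)
    then have "(1 - u) * q a \<le> (1 - u) * q x" "u * q b \<le> u * q x"
      using u x(2) by auto
    moreover have "q x < (1 - u) * q a + u * q b"
      using strict[OF ab u] by (simp flip: xu)
    ultimately show False by (simp add: algebra_simps)
  qed
  then have "x extreme_point_of K"
    using x(1) by (auto simp: extreme_point_of_def M_def)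
  then show ?thesis
    using that x(1) m(2) by (auto simp: M_def)
qed

text \<open>The reason is that 1 is an extreme point of the unit ball of \<open>'k\<close>. The
  inner product with 1, which is the real part for complex scalars, reduces this to real numbers: a
  weighted mean of two reals \<le> 1 with positive weights is 1 only if both are 1.\<close>

lemma face_of_value_one:
  fixes h :: "'a::real_vector \<Rightarrow> 'k::{real_normed_field, euclidean_space}"
  assumes "convex S" "linear h" and le: "\<And>x. x \<in> S \<Longrightarrow> norm (h x) \<le> 1"
  shows "{x \<in> S. h x = 1} face_of S"
proof -
  have one: "(1::'k) \<bullet> 1 = 1"
    by (metis norm_one norm_eq_1)
  \<comment> \<open>Expanding the square, \<open>(z - 1) \<bullet> (z - 1) = z \<bullet> z - 2 * (z
    \<bullet> 1) + 1\<close>, which is at most 1 - 2 + 1 = 0.\<close>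
  have eq1: "z = 1" if "norm z \<le> 1" "1 \<le> z \<bullet> 1" for z :: 'k
  proof -
    have "z \<bullet> z \<le> 1" using that(1) by (simp add: norm_eq_sqrt_inner)
    then have "(z - 1) \<bullet> (z - 1) \<le> 0"
      using that(2) one by (simp add: inner_diff inner_commute)
    then show ?thesis
      by (metis antisym eq_iff_diff_eq_0 inner_eq_zero_iff inner_ge_zero)
  qed
  have le1: "z \<bullet> 1 \<le> 1" if "norm z \<le> 1" for z :: 'k
    using that norm_cauchy_schwarz[of z 1] by simp
  have "h a = 1 \<and> h b = 1"
    if ab: "a \<in> S" "b \<in> S" and seg: "x \<in> open_segment a b" and hx: "h x = 1" for a b x
  proof -
    obtain u where u: "0 < u" "u < 1" and x: "x = (1 - u) *\<^sub>R a + u *\<^sub>R b"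
      using seg by (auto simp: in_segment)
    have "1 = ((1 - u) *\<^sub>R h a + u *\<^sub>R h b) \<bullet> 1"
      using hx assms(2) one by (simp add: x linear_add linear_scale)
    then have *: "1 = (1 - u) * (h a \<bullet> 1) + u * (h b \<bullet> 1)"
      by (simp add: inner_add_left)
    have "(1 - u) * (h a \<bullet> 1) \<le> 1 - u" "u * (h b \<bullet> 1) \<le> u"
      using u le1[OF le[OF ab(1)]] le1[OF le[OF ab(2)]] by auto
    with * have "(1 - u) * (h a \<bullet> 1) = 1 - u \<and> u * (h b \<bullet> 1) = u"
      by linarith
    then have "h a \<bullet> 1 = 1" "h b \<bullet> 1 = 1" using u by auto
    then show ?thesis using eq1 le ab by simp
  qed
  moreover have "{x \<in> S. h x = 1} = S \<inter> h -` {1}" by auto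
  then have "convex {x \<in> S. h x = 1}"
    using assms by (auto intro!: convex_Int convex_linear_vimage)
  ultimately show ?thesis
    unfolding face_of_def by auto
qed

lemma convex_on_powr_nonneg:
  fixes p :: real
  assumes "1 \<le> p"
  shows "convex_on {0..} (\<lambda>x. x powr p)"
proof (rule convex_on_linorderI)
  fix t x y :: real
  assume t: "0 < t" "t < 1" and x: "x \<in> {0..}" and "y \<in> {0..}" "x < y"
  then have y: "0 < y" by simp
  show "((1 - t) *\<^sub>R x + t *\<^sub>R y) powr p \<le> (1 - t) * x powr p + t * y powr p"
  proof (cases "x = 0")
    \<comment> \<open>At the endpoint 0 the inequality reduces to \<open>t powr p \<le> t\<close>
      for \<open>t\<close> between 0 and 1. Positive \<open>x\<close> and \<open>y\<close> are
      covered by \<open>powr_convex\<close>.\<close>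
    case True
    have "t powr p \<le> t powr 1"
      using t assms by (intro powr_mono') auto
    then show ?thesis
      using True t y by (simp add: powr_mult mult_right_mono)
  next
    case False
    then show ?thesis
      using convex_onD[OF powr_convex[OF assms], of t x y] x y t by simp
  qed
qed simp

text \<open>The norm of a linear map is convex, and composing it with a nondecreasing convex power
  preserves convexity. This serves for vectors with the functional fixed, and for functionals with
  the vector fixed.\<close>

lemma convex_on_sum_norm_powr:
  fixes L :: "'i \<Rightarrow> 'a::real_vector \<Rightarrow> 'b::real_normed_vector"
  assumes "1 \<le> p" "convex K" "\<And>i. i \<in> I \<Longrightarrow> linear (L i)"
  shows "convex_on K (\<lambda>x. \<Sum>i\<in>I. norm (L i x) powr p)"
proof (rule convex_onI)
  fix t x y assume t: "0 < t" "t < (1::real)" and "x \<in> K" "y \<in> K"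
  have "norm (L i ((1 - t) *\<^sub>R x + t *\<^sub>R y)) powr p
      \<le> (1 - t) * norm (L i x) powr p + t * norm (L i y) powr p" if "i \<in> I" for i
  proof -
    have "norm (L i ((1 - t) *\<^sub>R x + t *\<^sub>R y)) \<le> (1 - t) * norm (L i x) + t * norm (L i y)"
      using assms(3)[OF that] t norm_triangle_ineq[of "(1 - t) *\<^sub>R L i x" "t *\<^sub>R L i y"]
      by (simp add: linear_add linear_scale)
    then have "norm (L i ((1 - t) *\<^sub>R x + t *\<^sub>R y)) powr p
        \<le> ((1 - t) * norm (L i x) + t * norm (L i y)) powr p"
      using assms(1) by (intro powr_mono2) auto
    also have "\<dots> \<le> (1 - t) * norm (L i x) powr p + t * norm (L i y) powr p"
      using convex_onD[OF convex_on_powr_nonneg[OF assms(1)], of t "norm (L i x)" "norm (L i y)"] t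
      by simp
    finally show ?thesis .
  qed
  then show "(\<Sum>i\<in>I. norm (L i ((1 - t) *\<^sub>R x + t *\<^sub>R y)) powr p)
      \<le> (1 - t) * (\<Sum>i\<in>I. norm (L i x) powr p) + t * (\<Sum>i\<in>I. norm (L i y) powr p)"
    by (simp add: sum_mono sum_distrib_left flip: sum.distrib)
qed (use assms in auto)

section \<open>Restriction of scalars to the reals, and functionals over the scalar field\<close>

text \<open>Multiplying a basis over \<open>'k\<close> by the elements of a real basis of
  \<open>'k\<close> gives a finite real spanning set, so the results over the reals become
  available.\<close>

lemma finite_dim_imp_finite_real_span:
  fixes sc :: "'k::{real_normed_field, euclidean_space} \<Rightarrow> 'a::real_normed_vector \<Rightarrow> 'a"
  assumes "normed_space_over sc" "finite_dim sc"
  obtains S where "finite S" "span S = (UNIV :: 'a set)"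
proof -
  interpret X: normed_space_over sc by fact
  obtain B where "finite_dimensional_vector_space sc B"
    using assms(2) by (auto simp: finite_dim_def)
  then interpret F: finite_dimensional_vector_space sc B .
  define S where "S = (\<lambda>(b, i). sc i b) ` (B \<times> Basis)"
  have sc_span: "sc c b \<in> span S" if "b \<in> B" for c b
  proof -
    have "sc c b = sc (\<Sum>i\<in>Basis. (c \<bullet> i) *\<^sub>R i) b"
      by (simp add: euclidean_representation)
    also have "\<dots> = (\<Sum>i\<in>Basis. sc (of_real (c \<bullet> i)) (sc i b))"
      by (simp add: X.scale_sum_left scaleR_conv_of_real)
    also have "\<dots> = (\<Sum>i\<in>Basis. (c \<bullet> i) *\<^sub>R sc i b)"
      by (simp only: X.sc_of_real)
    also have "\<dots> \<in> span S"
      using that by (intro span_sum span_scale span_base) (auto simp: S_def)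
    finally show ?thesis .
  qed
  have "x \<in> span S" for x
  proof -
    have "x = (\<Sum>b\<in>B. sc (X.representation B x b) b)"
      using X.sum_representation_eq[OF F.independent_Basis, of x B] F.finite_Basis F.span_Basis
      by simp
    also have "\<dots> \<in> span S" by (intro span_sum sc_span)
    finally show ?thesis .
  qed
  then show ?thesis
    using F.finite_Basis by (intro that[of S]) (auto simp: S_def)
qed

text \<open>The functional is a coordinate with respect to a basis over \<open>'k\<close>, taken at
  a basis vector where \<open>x\<close> has a nonzero coefficient. Its boundedness comes from finite
  real dimension.\<close>

lemma nonzero_dual_functional:
  fixes sc :: "'k::{real_normed_field, euclidean_space} \<Rightarrow> 'a::real_normed_vector \<Rightarrow> 'a"
  assumes "normed_space_over sc" "finite_dim sc" "(x::'a) \<noteq> 0"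
  obtains g where "g \<in> dual sc" "g \<noteq> 0"
proof -
  interpret X: normed_space_over sc by fact
  obtain B where "finite_dimensional_vector_space sc B"
    using assms(2) by (auto simp: finite_dim_def)
  then interpret F: finite_dimensional_vector_space sc B .
  obtain S where S: "finite S" "span S = (UNIV :: 'a set)"
    using assms by (elim finite_dim_imp_finite_real_span)
  have "x = (\<Sum>b\<in>B. sc (X.representation B x b) b)"
    using X.sum_representation_eq[OF F.independent_Basis, of x B] F.finite_Basis F.span_Basis
    by simp
  then obtain b where b: "X.representation B x b \<noteq> 0"
    using assms(3) by (cases "\<forall>b\<in>B. X.representation B x b = 0") auto
  let ?l = "\<lambda>x. X.representation B x b"
  have l_scale: "?l (sc c y) = c * ?l y" for c y
    by (simp add: X.representation_scale F.independent_Basis F.span_Basis)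
  have "?l (r *\<^sub>R y) = r *\<^sub>R ?l y" for r y
    using l_scale[of "of_real r" y] by (simp add: X.sc_of_real scaleR_conv_of_real)
  then have "linear ?l"
    by (intro linearI) (simp_all add: X.representation_add F.independent_Basis F.span_Basis)
  then have apply_l: "blinfun_apply (Blinfun ?l) = ?l"
    by (intro bounded_linear_Blinfun_apply linear_bounded_finite_span[OF S])
  show ?thesis
  proof (rule that[of "Blinfun ?l"])
    show "Blinfun ?l \<in> dual sc" by (simp add: dual_def apply_l l_scale)
    show "Blinfun ?l \<noteq> 0" using b apply_l by (metis zero_blinfun.rep_eq)
  qed
qed

text \<open>Compactness of the unit ball yields a maximizer of \<open>norm (g x)\<close>, and
  normalizing vectors shows that the maximum is the operator norm.\<close>

lemma norm_blinfun_attained: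
  fixes g :: "'a::real_normed_vector \<Rightarrow>\<^sub>L 'b::real_normed_vector"
  assumes "finite S" "span S = (UNIV :: 'a set)"
  obtains x where "norm x \<le> 1" "norm (g x) = norm g"
proof -
  have "continuous_on (cball 0 1) (\<lambda>x. norm (g x))"
    by (intro continuous_intros)
  from continuous_attains_sup[OF compact_cball_finite_span[OF assms] _ this]
  obtain x where x: "norm x \<le> 1" "\<And>y. norm y \<le> 1 \<Longrightarrow> norm (g y) \<le> norm (g x)"
    by auto
  have "norm g \<le> norm (g x)"
  proof (rule norm_blinfun_bound)
    fix y
    show "norm (g y) \<le> norm (g x) * norm y"
    proof (cases "y = 0")
      case False
      then have "norm (g (y /\<^sub>R norm y)) \<le> norm (g x)" by (intro x) simp
      then show ?thesis using False by (simp add: blinfun.scaleR_right field_simps)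
    qed simp
  qed simp
  moreover have "norm (g x) \<le> norm g"
    using norm_blinfun[of g x] x(1) by (meson mult_left_le norm_ge_zero order_trans)
  ultimately show ?thesis using that x(1) by simp
qed

section \<open>The set of admissible pairs: nonemptiness and compactness\<close>

text \<open>The chain \<open>1 = norm (f x) \<le> norm f * norm x\<close> forces both norms up to
  1.\<close>

lemma Pi_pairsI:
  assumes "f \<in> dual sc" "norm x \<le> 1" "norm f \<le> 1" "blinfun_apply f x = 1"
  shows "(x, f) \<in> Pi_pairs sc"
proof -
  have 1: "1 \<le> norm f * norm x"
    using norm_blinfun[of f x] assms(4) by simp
  also have "\<dots> \<le> norm x" using assms(3) by (simp add: mult_left_le_one_le)
  finally have "norm x = 1" using assms(2) by simp
  moreover from this 1 have "norm f = 1" using assms(3) by simp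
  ultimately show ?thesis using assms by (simp add: Pi_pairs_def)
qed

text \<open>Spheres are replaced by balls, so that fixing one component of a pair leaves a slice of
  a convex set for the other.\<close>

lemma Pi_pairs_eq:
  "Pi_pairs sc = {(x, f). x \<in> cball 0 1 \<and> f \<in> dual sc \<inter> cball 0 1 \<and> blinfun_apply f x = 1}"
proof (rule set_eqI)
  fix z
  show "z \<in> Pi_pairs sc \<longleftrightarrow>
      z \<in> {(x, f). x \<in> cball 0 1 \<and> f \<in> dual sc \<inter> cball 0 1 \<and> blinfun_apply f x = 1}"
    using Pi_pairsI[of "snd z" sc "fst z"] by (cases z) (auto simp: Pi_pairs_def)
qed

text \<open>Since only one such pair is required, attaining the norm of an arbitrary nonzero functional
  replaces the Hahn-Banach theorem.\<close>
lemma Pi_pairs_nonempty: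
  fixes sc :: "'k::{real_normed_field, euclidean_space} \<Rightarrow> 'a::real_normed_vector \<Rightarrow> 'a"
  assumes X: "normed_space_over sc" and "finite_dim sc" "(y::'a) \<noteq> 0"
  shows "Pi_pairs sc \<noteq> {}"
proof -
  interpret X: normed_space_over sc by fact
  obtain S where S: "finite S" "span S = (UNIV :: 'a set)"
    using assms by (elim finite_dim_imp_finite_real_span)
  obtain g where g: "g \<in> dual sc" "g \<noteq> 0"
    using nonzero_dual_functional[OF assms] .
  obtain x where x: "norm x \<le> 1" "norm (g x) = norm g"
    using norm_blinfun_attained[OF S] .
  \<comment> \<open>A scalar of norm 1 that rotates \<open>x\<close> so that \<open>g\<close> takes
    the value \<open>norm g\<close> at \<open>sc c x\<close>; dividing \<open>g\<close> by its norm
    then gives the value 1.\<close>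
  define c where "c = of_real (norm g) / g x"
  have "norm c = 1" using g x by (simp add: c_def norm_divide)
  moreover have "g x \<noteq> 0" using x(2) g(2) by fastforce
  ultimately have "(sc c x, (1 / norm g) *\<^sub>R g) \<in> Pi_pairs sc"
    using g x by (intro Pi_pairsI)
      (simp_all add: dual_def X.norm_sc blinfun.scaleR_left c_def scaleR_conv_of_real flip: of_real_mult)
  then show ?thesis by blast
qed

lemma closed_dual: "closed (dual sc)"
proof -
  have "dual sc = (\<Inter>c. \<Inter>x. {f. blinfun_apply f (sc c x) = c * blinfun_apply f x})"
    by (auto simp: dual_def)
  moreover have "closed {f. blinfun_apply f (sc c x) = c * blinfun_apply f x}" for c x
    by (intro closed_Collect_eq continuous_intros)
  ultimately show ?thesis by (simp add: closed_INT)
qed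

lemma convex_dual: "convex (dual sc)"
  by (intro convexI) (simp add: dual_def blinfun.add_left blinfun.scaleR_left algebra_simps)

text \<open>The evaluation is jointly continuous, so the condition \<open>f x = 1\<close> cuts a
  closed set out of a product of two compact sets.\<close>

lemma compact_Pi_pairs:
  fixes sc :: "'k::{real_normed_field, euclidean_space} \<Rightarrow> 'a::real_normed_vector \<Rightarrow> 'a"
  assumes S: "finite S" "span S = (UNIV :: 'a set)"
  shows "compact (Pi_pairs sc)"
proof -
  obtain E where E: "finite E" "span E = (UNIV :: ('a \<Rightarrow>\<^sub>L 'k) set)"
    using S by (rule finite_span_blinfun)
  have "Pi_pairs sc = (cball 0 1 \<times> (cball 0 1 \<inter> dual sc)) \<inter> {z. blinfun_apply (snd z) (fst z) = 1}"
    by (auto simp: Pi_pairs_eq)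
  moreover have "closed {z :: 'a \<times> ('a \<Rightarrow>\<^sub>L 'k). blinfun_apply (snd z) (fst z) = 1}"
    by (intro closed_Collect_eq continuous_intros)
  ultimately show ?thesis
    using compact_cball_finite_span[OF S] compact_cball_finite_span[OF E]
    by (auto intro!: compact_Int_closed compact_Times closed_dual)
qed

lemma continuous_on_sum_norm_powr:
  fixes L :: "'i \<Rightarrow> 'a::topological_space \<Rightarrow> 'b::real_normed_vector"
  assumes "0 < p" "\<And>i. i \<in> I \<Longrightarrow> continuous_on K (L i)"
  shows "continuous_on K (\<lambda>x. \<Sum>i\<in>I. norm (L i x) powr p)"
  using assms by (intro continuous_on_sum continuous_on_powr' continuous_on_norm continuous_on_const) auto

section \<open>Passage from an arbitrary maximizing pair to a pair of extreme points\<close>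

text \<open>The scalar type is kept generic so that the real and the complex case are both
  instances.\<close>

lemma joint_numerical_radius_is_maximum:
  fixes sc :: "'k::{real_normed_field, euclidean_space} \<Rightarrow> 'a::real_normed_vector \<Rightarrow> 'a"
  assumes X: "normed_space_over sc" "finite_dim sc" "(y::'a) \<noteq> 0" and p: "1 \<le> p"
  shows "is_maximum (joint_numerical_radius sc p k T) (joint_value p k T ` G_pairs sc)"
proof -
  obtain S where S: "finite S" "span S = (UNIV :: 'a set)"
    using X(1,2) by (rule finite_dim_imp_finite_real_span)
  obtain E where E: "finite E" "span E = (UNIV :: ('a \<Rightarrow>\<^sub>L 'k) set)"
    using S by (rule finite_span_blinfun)
  \<comment> \<open>The p-th power of \<open>joint_value\<close>: without the outer root it is
    convex in each variable separately, and it has the same maximizers.\<close>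
  define \<Phi> :: "'a \<Rightarrow> ('a \<Rightarrow>\<^sub>L 'k) \<Rightarrow> real"
    where "\<Phi> x f = (\<Sum>i=1..k. norm (f (T i x)) powr p)" for x f
  have "continuous_on (Pi_pairs sc) (\<lambda>z. \<Phi> (fst z) (snd z))"
    unfolding \<Phi>_def using p by (intro continuous_on_sum_norm_powr continuous_intros) auto
  then obtain x0 f0 where xf0: "(x0, f0) \<in> Pi_pairs sc"
    and max0: "\<And>x f. (x, f) \<in> Pi_pairs sc \<Longrightarrow> \<Phi> x f \<le> \<Phi> x0 f0"
    using continuous_attains_sup[OF compact_Pi_pairs[OF S] Pi_pairs_nonempty[OF X]] by fastforce

  define F where "F = {x \<in> cball 0 1. f0 x = 1}"
  have F: "F face_of cball 0 1"
    unfolding F_def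
  proof (rule face_of_value_one)
    show "norm (f0 x) \<le> 1" if "x \<in> cball 0 1" for x
      using norm_blinfun[of f0 x] xf0 that by (simp add: Pi_pairs_def)
  qed (auto intro: blinfun.bounded_linear_right bounded_linear.linear)
  have "F = cball 0 1 \<inter> {x. f0 x = 1}" by (auto simp: F_def)
  then have "compact F"
    by (auto intro!: compact_Int_closed compact_cball_finite_span[OF S] closed_Collect_eq
        continuous_intros)
  moreover have "x0 \<in> F" using xf0 by (simp add: F_def Pi_pairs_def)
  then have "F \<noteq> {}" by blast
  moreover have "continuous_on F (\<lambda>x. \<Phi> x f0)"
    unfolding \<Phi>_def using p by (intro continuous_on_sum_norm_powr continuous_intros) auto
  moreover have "convex_on F (\<lambda>x. \<Phi> x f0)"
    unfolding \<Phi>_def using p face_of_imp_convex[OF F]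
    by (intro convex_on_sum_norm_powr linearI) (auto simp: blinfun.add_right blinfun.scaleR_right)
  ultimately obtain x1 where x1: "x1 extreme_point_of F" "\<And>x. x \<in> F \<Longrightarrow> \<Phi> x f0 \<le> \<Phi> x1 f0"
    by (rule convex_maximum_at_extreme_point[OF S]) blast
  \<comment> \<open>Extreme points of a face are exactly the extreme points of the whole set that
    lie in the face.\<close>
  have x1': "x1 extreme_point_of cball 0 1" "x1 \<in> F"
    using x1(1) extreme_point_of_face[OF F] by auto
  then have xf1: "(x1, f0) \<in> Pi_pairs sc"
    using xf0 by (auto simp: F_def Pi_pairs_eq)

  \<comment> \<open>The dual ball consists of functionals linear over \<open>'k\<close>; extremality
    of the functional is meant in this set, not in the ball of all bounded real-linear maps.\<close>
  define D where "D = dual sc \<inter> cball 0 1"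
  define H where "H = {f \<in> D. blinfun_apply f x1 = 1}"
  have H: "H face_of D"
    unfolding H_def
  proof (rule face_of_value_one)
    show "convex D" unfolding D_def by (intro convex_Int convex_dual convex_cball)
    show "linear (\<lambda>f :: 'a \<Rightarrow>\<^sub>L 'k. f x1)"
      by (auto intro: linearI simp: blinfun.add_left blinfun.scaleR_left)
    show "norm (f x1) \<le> 1" if "f \<in> D" for f
      using norm_blinfun[of f x1] xf1 that by (simp add: Pi_pairs_def D_def)
  qed
  have "H = cball 0 1 \<inter> (dual sc \<inter> {f. blinfun_apply f x1 = 1})" by (auto simp: H_def D_def)
  then have "compact H"
    by (auto intro!: compact_Int_closed compact_cball_finite_span[OF E] closed_Collect_eq closed_Int
        closed_dual continuous_intros)
  moreover have "f0 \<in> H" using xf1 by (simp add: H_def D_def Pi_pairs_def)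
  then have "H \<noteq> {}" by blast
  moreover have "continuous_on H (\<Phi> x1)"
    unfolding \<Phi>_def using p by (intro continuous_on_sum_norm_powr continuous_intros) auto
  moreover have "convex_on H (\<Phi> x1)"
    unfolding \<Phi>_def using p face_of_imp_convex[OF H]
    by (intro convex_on_sum_norm_powr linearI) (auto simp: blinfun.add_left blinfun.scaleR_left)
  ultimately obtain f1 where f1: "f1 extreme_point_of H" "\<And>f. f \<in> H \<Longrightarrow> \<Phi> x1 f \<le> \<Phi> x1 f1"
    by (rule convex_maximum_at_extreme_point[OF E]) blast
  have f1': "f1 extreme_point_of D" "f1 \<in> H"
    using f1(1) extreme_point_of_face[OF H] by auto
  have G: "(x1, f1) \<in> G_pairs sc"
    using f1' x1' by (auto simp: G_pairs_def Pi_pairs_eq H_def D_def F_def)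

  have "\<Phi> x0 f0 \<le> \<Phi> x1 f0"
    using xf0 by (intro x1) (auto simp: F_def Pi_pairs_def)
  also have "\<dots> \<le> \<Phi> x1 f1"
    using xf1 by (intro f1) (auto simp: H_def D_def Pi_pairs_def)
  finally have "\<Phi> x f \<le> \<Phi> x1 f1" if "(x, f) \<in> Pi_pairs sc" for x f
    using max0[OF that] by simp
  \<comment> \<open>The outer power \<open>1 / p\<close> is nondecreasing on nonnegative reals, so
    the comparison of sums carries over.\<close>
  then have le: "joint_value p k T z \<le> joint_value p k T (x1, f1)" if "z \<in> Pi_pairs sc" for z
    using that p
    by (cases z) (auto simp: joint_value_def \<Phi>_def intro!: powr_mono2 sum_nonneg)
  have sub: "G_pairs sc \<subseteq> Pi_pairs sc" by (auto simp: G_pairs_def)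
  \<comment> \<open>The pair \<open>(x1, f1)\<close> lies in \<open>Pi_pairs sc\<close> and
    dominates it, so the supremum is its value; as it also lies in \<open>G_pairs sc\<close>, the
    maximum over the smaller set is the same.\<close>
  have "joint_numerical_radius sc p k T = joint_value p k T (x1, f1)"
    unfolding joint_numerical_radius_def using G sub le
    by (intro cSup_eq_maximum) auto
  then show ?thesis
    using G sub le by (auto simp: is_maximum_def)
qed

theorem theorem2p5:
  fixes p :: real and k :: nat
    and T :: "nat \<Rightarrow> 'a::banach \<Rightarrow>\<^sub>L 'a"
    and scaleC :: "complex \<Rightarrow> 'b::banach \<Rightarrow> 'b"
    and U :: "nat \<Rightarrow> 'b \<Rightarrow>\<^sub>L 'b"
  assumes "1 \<le> p"
  shows
    "(finite_dim (scaleR :: real \<Rightarrow> 'a \<Rightarrow> 'a) \<and> (\<exists>x::'a. x \<noteq> 0) \<and>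
      (\<forall>i\<in>{1..k}. T i \<in> operators (scaleR :: real \<Rightarrow> 'a \<Rightarrow> 'a))
      \<longrightarrow> is_maximum (joint_numerical_radius (scaleR :: real \<Rightarrow> 'a \<Rightarrow> 'a) p k T)
            (joint_value p k T ` G_pairs (scaleR :: real \<Rightarrow> 'a \<Rightarrow> 'a)))
     \<and>
     (normed_space_over scaleC \<and> finite_dim scaleC \<and> (\<exists>x::'b. x \<noteq> 0) \<and>
      (\<forall>i\<in>{1..k}. U i \<in> operators scaleC)
      \<longrightarrow> is_maximum (joint_numerical_radius scaleC p k U)
            (joint_value p k U ` G_pairs scaleC))"
proof (intro conjI impI)
  assume "finite_dim (scaleR :: real \<Rightarrow> 'a \<Rightarrow> 'a) \<and> (\<exists>x::'a. x \<noteq> 0) \<and>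
      (\<forall>i\<in>{1..k}. T i \<in> operators (scaleR :: real \<Rightarrow> 'a \<Rightarrow> 'a))"
  then show "is_maximum (joint_numerical_radius (scaleR :: real \<Rightarrow> 'a \<Rightarrow> 'a) p k T)
      (joint_value p k T ` G_pairs (scaleR :: real \<Rightarrow> 'a \<Rightarrow> 'a))"
    using assms by (elim conjE exE) (rule joint_numerical_radius_is_maximum[OF normed_space_over_scaleR])
next
  assume "normed_space_over scaleC \<and> finite_dim scaleC \<and> (\<exists>x::'b. x \<noteq> 0) \<and>
      (\<forall>i\<in>{1..k}. U i \<in> operators scaleC)"
  then show "is_maximum (joint_numerical_radius scaleC p k U) (joint_value p k U ` G_pairs scaleC)"
    using assms by (elim conjE exE) (rule joint_numerical_radius_is_maximum)
qed

end
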